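(* Let $b\ge2$, $s\ge1$, $n\ge1$ be integers and let $P\subset\mathbb{Z}_b^{s\times n}$ be a subgroup. Then $$\mathrm{WF}(P)=-1+\frac1{|P|}\sum_{B\in P}\ \prod_{1\le i\le s,\ 1\le j\le n}\bigl(1+\eta(b_{i,j})\,b^{-j}\bigr),$$ where $B=(b_{i,j})$, $\eta(b_{i,j})=b-1$ if $b_{i,j}=0$ and $\eta(b_{i,j})=-1$ if $b_{i,j}\ne0$.
   Context: $\mathbb{Z}_b=\mathbb{Z}/b\mathbb{Z}$ and $\mathbb{Z}_b^{s\times n}$ is the additive group of $s\times n$ matrices over $\mathbb{Z}_b$, with zero matrix $O$. Put $\omega_b=\exp(2\pi\sqrt{-1}/b)$ and $A\bullet B=\prod_{i,j}\omega_b^{a_{i,j}b_{i,j}}$ for $A=(a_{i,j}),B=(b_{i,j})\in\mathbb{Z}_b^{s\times n}$, which identifies $\mathbb{Z}_b^{s\times n}$ with its character group. $P^\perp=\{A\in\mathbb{Z}_b^{s\times n}:A\bullet B=1\text{ for all }B\in P\}$. The Dick weight is $\mu(A)=\sum_{i,j}j\,\delta(a_{i,j})$ with $\delta(0)=0$ and $\delta(h)=1$ for $h\ne0$. The Walsh figure of merit (WAFOM) is $\mathrm{WF}(P)=\sum_{A\in P^\perp\setminus\{O\}}b^{-\mu(A)}$. *)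

theory Defs
  imports Complex_Main "HOL-Algebra.Elementary_Groups" "HOL-Algebra.Product_Groups"
begin

definition mat_idx :: "nat \<Rightarrow> nat \<Rightarrow> (nat \<times> nat) set" where
  "mat_idx s n = {1..s} \<times> {1..n}"

text \<open>Rows and columns are numbered from 1. Matrices are extensional functions on the index
  set, and residue classes are represented by integers in \<open>{0..<b}\<close>, so equality of matrices is
  equality in HOL.\<close>

definition zmat :: "nat \<Rightarrow> nat \<Rightarrow> nat \<Rightarrow> (nat \<times> nat \<Rightarrow> int) monoid" where
  "zmat b s n = product_group (mat_idx s n) (\<lambda>_. integer_mod_group b)"

definition omega :: "nat \<Rightarrow> complex" where
  "omega b = exp (2 * of_real pi * \<i> / of_nat b)"

text \<open>The exponent below is the product of the integer representatives; it matters only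
  modulo \<open>b\<close>, since \<open>omega b\<close> is a \<open>b\<close>-th root of unity.\<close>

definition bullet ::
    "nat \<Rightarrow> nat \<Rightarrow> nat \<Rightarrow> (nat \<times> nat \<Rightarrow> int) \<Rightarrow> (nat \<times> nat \<Rightarrow> int) \<Rightarrow> complex" where
  "bullet b s n A B = (\<Prod>(i,j)\<in>mat_idx s n. omega b powi (A (i,j) * B (i,j)))"

definition perp ::
    "nat \<Rightarrow> nat \<Rightarrow> nat \<Rightarrow> (nat \<times> nat \<Rightarrow> int) set \<Rightarrow> (nat \<times> nat \<Rightarrow> int) set" where
  "perp b s n P = {A \<in> carrier (zmat b s n). \<forall>B\<in>P. bullet b s n A B = 1}"

definition delta :: "int \<Rightarrow> nat" where
  "delta h = (if h = 0 then 0 else 1)"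

definition dick_weight :: "nat \<Rightarrow> nat \<Rightarrow> (nat \<times> nat \<Rightarrow> int) \<Rightarrow> nat" where
  "dick_weight s n A = (\<Sum>(i,j)\<in>mat_idx s n. j * delta (A (i,j)))"

text \<open>The neutral element of \<open>zmat b s n\<close> is the zero matrix.\<close>

definition WF :: "nat \<Rightarrow> nat \<Rightarrow> nat \<Rightarrow> (nat \<times> nat \<Rightarrow> int) set \<Rightarrow> real" where
  "WF b s n P =
     (\<Sum>A\<in>perp b s n P - {\<one>\<^bsub>zmat b s n\<^esub>}. real b powi (- int (dick_weight s n A)))"

definition eta :: "nat \<Rightarrow> int \<Rightarrow> real" where
  "eta b h = (if h = 0 then real b - 1 else - 1)"

end

theory Submission
  imports Defs "HOL-Library.Real_Mod"
begin

text \<open>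
  The identity is Poisson summation on the finite group of matrices for the function
  \<open>A \<mapsto> b\<^bsup>-\<mu>(A)\<^esup>\<close>. Double-count the sum of \<open>(A \<bullet> B) b\<^bsup>-\<mu>(A)\<^esup>\<close> over all matrices \<open>A\<close> and
  all \<open>B \<in> P\<close>.

  For fixed \<open>A\<close>, the map \<open>B \<mapsto> A \<bullet> B\<close> is a character of \<open>P\<close>, so its sum over \<open>P\<close> is \<open>|P|\<close> if
  \<open>A\<close> lies in the dual of \<open>P\<close> and \<open>0\<close> otherwise (\<open>sum_character_subgroup\<close>). This gives \<open>|P|\<close>
  times the sum of \<open>b\<^bsup>-\<mu>(A)\<^esup>\<close> over the dual, in which the zero matrix, absent from the figure of
  merit, contributes \<open>1\<close>.

  For fixed \<open>B\<close>, both \<open>A \<bullet> B\<close> and \<open>b\<^bsup>-\<mu>(A)\<^esup>\<close> are products over the matrix positions, so the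
  sum over all \<open>A\<close> factors into sums over single residues (\<open>sum_bullet_weight\<close>). At position
  \<open>(i,j)\<close> the residue \<open>0\<close> contributes \<open>1\<close>, and the nonzero residues contribute \<open>b\<^bsup>-j\<^esup>\<close> times a
  sum of nontrivial powers of a root of unity, which is \<open>\<eta>\<close> of the entry of \<open>B\<close>
  (\<open>sum_residues_weight\<close>).
\<close>

section \<open>Characters of a subgroup\<close>

text \<open>
  Translating the summation variable by an element where \<open>\<chi>\<close> takes a value \<open>c \<noteq> 1\<close> multiplies the
  sum by \<open>c\<close> without changing it, so the sum vanishes.
\<close>

lemma sum_character_subgroup:
  fixes \<chi> :: "'a \<Rightarrow> 'c::idom"
  assumes "group G" and P: "subgroup P G"
    and mult: "\<And>x y. x \<in> P \<Longrightarrow> y \<in> P \<Longrightarrow> \<chi> (x \<otimes>\<^bsub>G\<^esub> y) = \<chi> x * \<chi> y"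
  shows "(\<Sum>x\<in>P. \<chi> x) = (if \<forall>x\<in>P. \<chi> x = 1 then of_nat (card P) else 0)"
proof (cases "\<forall>x\<in>P. \<chi> x = 1")
  case True
  then show ?thesis by simp
next
  case False
  then obtain x where x: "x \<in> P" "\<chi> x \<noteq> 1" by blast
  interpret group G by fact
  interpret H: group "G\<lparr>carrier := P\<rparr>"
    using P by (rule subgroup_imp_group)
  have "bij_betw ((\<otimes>\<^bsub>G\<^esub>) x) P P"
    using H.inj_on_cmult[of x] H.surj_const_mult[of x] x by (simp add: bij_betw_def)
  then have "(\<Sum>y\<in>P. \<chi> y) = (\<Sum>y\<in>P. \<chi> (x \<otimes>\<^bsub>G\<^esub> y))"
    by (simp add: sum.reindex_bij_betw)
  also have "\<dots> = \<chi> x * (\<Sum>y\<in>P. \<chi> y)"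
    using x mult by (simp add: sum_distrib_left)
  finally have "(\<Sum>y\<in>P. \<chi> y) = 0" using x by simp
  then show ?thesis by (simp only: False if_False)
qed

section \<open>Roots of unity\<close>

lemma omega_nonzero [simp]: "omega b \<noteq> 0"
  by (simp add: omega_def)

lemma omega_powi_eq_1_iff:
  assumes "b > 0"
  shows "omega b powi k = 1 \<longleftrightarrow> int b dvd k"
proof -
  have "omega b = cis (2 * pi / b)"
    by (simp add: omega_def cis_conv_exp mult_ac)
  then have "omega b powi k = cis (of_int k * (2 * pi / b))"
    by (simp add: cis_power_int)
  also have "\<dots> = 1 \<longleftrightarrow> (\<exists>m. of_int k * (2 * pi / b) = of_int m * (2 * pi))"
    by (rule cis_eq_1_iff)
  also have "\<dots> \<longleftrightarrow> (\<exists>m. k = int b * m)"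
  proof (rule arg_cong[where f = Ex], rule ext)
    fix m
    have "of_int k * (2 * pi / b) = of_int m * (2 * pi) \<longleftrightarrow> real_of_int k = real_of_int (int b * m)"
      using assms by (auto simp: field_simps)
    then show "(of_int k * (2 * pi / b) = of_int m * (2 * pi)) = (k = int b * m)"
      by (simp only: of_int_eq_iff)
  qed
  finally show ?thesis by (simp add: dvd_def)
qed

lemma omega_powi_cong:
  assumes "b > 0" and "int b dvd k - l"
  shows "omega b powi k = omega b powi l"
proof -
  have "omega b powi k = omega b powi (k - l) * omega b powi l"
    using power_int_add[of "omega b" "k - l" l] by simp
  then show ?thesis using assms omega_powi_eq_1_iff by simp
qed

lemma sum_omega_powi:
  assumes "b > 0"
  shows "(\<Sum>a\<in>{0..<int b}. omega b powi (a * h)) = (if int b dvd h then of_nat b else 0)"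
proof -
  have "(\<Sum>a\<in>{0..<int b}. omega b powi (a * h)) = (\<Sum>a<b. omega b powi (int a * h))"
    by (rule sum.reindex_bij_witness[where i = int and j = nat]) auto
  also have "\<dots> = (\<Sum>a<b. (omega b powi h) ^ a)"
    by (simp add: power_int_mult mult.commute[of _ h])
  also have "\<dots> = (if int b dvd h then of_nat b else 0)"
  proof -
    have "(omega b powi h) ^ b = omega b powi (h * int b)"
      by (simp add: power_int_mult)
    then have "(omega b powi h) ^ b = 1"
      using omega_powi_eq_1_iff[OF assms] by simp
    then show ?thesis
      using omega_powi_eq_1_iff[OF assms] by (simp add: sum_gp_strict)
  qed
  finally show ?thesis .
qed

section \<open>The Fourier transform of the weight\<close>

text \<open>
  The weight takes the constant value \<open>b\<^bsup>-j\<^esup>\<close> on nonzero residues, so all that matters is the sum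
  of the nontrivial powers, which is the full sum \<open>b\<close> or \<open>0\<close> less the term \<open>1\<close> of \<open>a = 0\<close>.
\<close>

lemma sum_residues_weight:
  assumes "b > 0" and h: "h \<in> {0..<int b}"
  shows "(\<Sum>a\<in>{0..<int b}. omega b powi (a * h) * of_real (real b powi - int (j * delta a)))
    = of_real (1 + eta b h * real b powi - int j)"
proof -
  have split: "{0..<int b} = insert 0 {1..<int b}"
    using assms by auto
  have "int b dvd h \<longleftrightarrow> h = 0"
    using h by (auto dest: zdvd_imp_le simp: order_le_less)
  then have "1 + (\<Sum>a\<in>{1..<int b}. omega b powi (a * h)) = (if h = 0 then of_nat b else 0)"
    using sum_omega_powi[OF assms(1), of h] by (simp add: split)
  then have "(\<Sum>a\<in>{1..<int b}. omega b powi (a * h)) = (if h = 0 then of_nat b else 0) - 1"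
    by (simp add: algebra_simps)
  also have "\<dots> = of_real (eta b h)"
    by (simp add: eta_def)
  finally have nonzero: "(\<Sum>a\<in>{1..<int b}. omega b powi (a * h)) = of_real (eta b h)" .
  have "(\<Sum>a\<in>{0..<int b}. omega b powi (a * h) * of_real (real b powi - int (j * delta a)))
      = 1 + (\<Sum>a\<in>{1..<int b}. omega b powi (a * h) * of_real (real b powi - int (j * delta a)))"
    by (simp add: split delta_def)
  also have "(\<Sum>a\<in>{1..<int b}. omega b powi (a * h) * of_real (real b powi - int (j * delta a)))
      = (\<Sum>a\<in>{1..<int b}. omega b powi (a * h) * of_real (real b powi - int j))"
    by (intro sum.cong) (auto simp: delta_def)
  also have "\<dots> = of_real (eta b h * real b powi - int j)"
    by (simp add: sum_distrib_right[symmetric] nonzero)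
  finally show ?thesis by simp
qed

lemma finite_mat_idx [simp]: "finite (mat_idx s n)"
  by (simp add: mat_idx_def)

lemma carrier_zmat:
  "b > 0 \<Longrightarrow> carrier (zmat b s n) = (\<Pi>\<^sub>E p\<in>mat_idx s n. {0..<int b})"
  by (simp add: zmat_def carrier_integer_mod_group)

lemma group_zmat: "group (zmat b s n)"
  by (simp add: zmat_def)

lemma powi_dick_weight:
  "real b powi - int (dick_weight s n A)
    = (\<Prod>(i,j)\<in>mat_idx s n. real b powi - int (j * delta (A (i,j))))"
  by (simp add: dick_weight_def power_int_minus power_sum prod_inversef[symmetric]
      case_prod_unfold del: of_nat_sum of_nat_mult)

text \<open>
  The matrices form the product, over all positions, of the set of residues, so the distributive
  law turns the sum over matrices into a product of sums over residues.
\<close>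

lemma sum_bullet_weight:
  assumes "b > 0" and B: "B \<in> carrier (zmat b s n)"
  shows "(\<Sum>A\<in>carrier (zmat b s n).
      bullet b s n A B * of_real (real b powi - int (dick_weight s n A)))
    = of_real (\<Prod>(i,j)\<in>mat_idx s n. 1 + eta b (B (i,j)) * real b powi - int j)"
proof -
  have "(\<Sum>A\<in>carrier (zmat b s n).
      bullet b s n A B * of_real (real b powi - int (dick_weight s n A)))
    = (\<Sum>A\<in>(\<Pi>\<^sub>E p\<in>mat_idx s n. {0..<int b}). \<Prod>p\<in>mat_idx s n.
        omega b powi (A p * B p) * of_real (real b powi - int (snd p * delta (A p))))"
    by (simp only: carrier_zmat[OF assms(1)] bullet_def powi_dick_weight case_prod_unfold
        of_real_prod prod.distrib prod.collapse)
  also have "\<dots> = (\<Prod>p\<in>mat_idx s n. \<Sum>a\<in>{0..<int b}.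
        omega b powi (a * B p) * of_real (real b powi - int (snd p * delta a)))"
    by (rule prod_sum_PiE[symmetric]) auto
  also have "\<dots> = (\<Prod>p\<in>mat_idx s n. of_real (1 + eta b (B p) * real b powi - int (snd p)))"
    using B assms(1) by (intro prod.cong refl sum_residues_weight) (auto simp: carrier_zmat)
  finally show ?thesis by (simp add: case_prod_unfold)
qed

section \<open>The dual of a subgroup\<close>

text \<open>
  Addition of matrices reduces each entry modulo \<open>b\<close>, which the \<open>b\<close>-th root of unity does not see.
\<close>

lemma bullet_mult:
  assumes "b > 0"
  shows "bullet b s n A (B \<otimes>\<^bsub>zmat b s n\<^esub> C) = bullet b s n A B * bullet b s n A C"
proof -
  have "omega b powi (a * ((x + y) mod int b)) = omega b powi (a * x) * omega b powi (a * y)"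
    for a x y
  proof -
    have "int b dvd a * ((x + y) mod int b) - a * (x + y)"
      by (metis mod_eq_dvd_iff mod_mult_right_eq)
    then have "omega b powi (a * ((x + y) mod int b)) = omega b powi (a * (x + y))"
      using assms by (intro omega_powi_cong)
    then show ?thesis by (simp add: distrib_left power_int_add)
  qed
  then show ?thesis
    by (simp add: bullet_def zmat_def case_prod_unfold prod.distrib[symmetric])
qed

lemma sum_bullet_subgroup:
  assumes "b > 0" and P: "subgroup P (zmat b s n)" and A: "A \<in> carrier (zmat b s n)"
  shows "(\<Sum>B\<in>P. bullet b s n A B) = (if A \<in> perp b s n P then of_nat (card P) else 0)"
  using sum_character_subgroup[OF group_zmat P, of "bullet b s n A"] A
  by (simp add: bullet_mult[OF assms(1)] perp_def)

lemma zero_mem_perp: "\<one>\<^bsub>zmat b s n\<^esub> \<in> perp b s n P"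
proof -
  have "\<one>\<^bsub>zmat b s n\<^esub> \<in> carrier (zmat b s n)"
    using group_zmat by (rule group.is_monoid[THEN monoid.one_closed])
  moreover have "bullet b s n \<one>\<^bsub>zmat b s n\<^esub> B = 1" for B
    by (simp add: bullet_def zmat_def case_prod_unfold)
  ultimately show ?thesis by (simp add: perp_def)
qed

lemma dick_weight_zero: "dick_weight s n \<one>\<^bsub>zmat b s n\<^esub> = 0"
  by (simp add: dick_weight_def zmat_def delta_def case_prod_unfold)

theorem corollary4p4:
  fixes b s n :: nat and P :: "(nat \<times> nat \<Rightarrow> int) set"
  assumes "b \<ge> 2" and "s \<ge> 1" and "n \<ge> 1"
    and "subgroup P (zmat b s n)"
  shows "WF b s n P =
    - 1 + 1 / real (card P) *
      (\<Sum>B\<in>P. \<Prod>(i,j)\<in>mat_idx s n. (1 + eta b (B (i,j)) * real b powi (- int j)))"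
proof -
  define G where "G = zmat b s n"
  define D where "D = perp b s n P"
  define w where "w = (\<lambda>A. real b powi - int (dick_weight s n A))"
  define R where "R = (\<Sum>B\<in>P. \<Prod>(i,j)\<in>mat_idx s n. (1 + eta b (B (i,j)) * real b powi (- int j)))"
  have b: "b > 0" using assms(1) by simp
  have PG: "P \<subseteq> carrier G"
    using assms(4) by (simp add: G_def subgroup.subset)
  have fin: "finite (carrier G)"
    by (simp add: G_def carrier_zmat[OF b] finite_PiE)
  then have finD: "finite D" and DG: "D \<subseteq> carrier G"
    by (auto simp: D_def perp_def G_def)
  have "P \<noteq> {}"
    using assms(4) subgroup.one_closed by blast
  then have card: "card P > 0"
    using finite_subset[OF PG fin] by (simp add: card_gt_0_iff)
  have "complex_of_real R = (\<Sum>B\<in>P. \<Sum>A\<in>carrier G. bullet b s n A B * of_real (w A))"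
    unfolding R_def of_real_sum G_def w_def
    using PG by (intro sum.cong refl sum_bullet_weight[symmetric] b) (auto simp: G_def)
  also have "\<dots> = (\<Sum>A\<in>carrier G. (\<Sum>B\<in>P. bullet b s n A B) * of_real (w A))"
    by (subst sum.swap) (simp add: sum_distrib_right)
  also have "\<dots> = (\<Sum>A\<in>carrier G. if A \<in> D then of_nat (card P) * of_real (w A) else 0)"
    by (intro sum.cong refl) (simp add: sum_bullet_subgroup[OF b assms(4)] G_def D_def)
  also have "\<dots> = (\<Sum>A\<in>D. of_nat (card P) * of_real (w A))"
    using DG fin by (simp add: sum.inter_restrict[symmetric] Int_absorb1)
  also have "\<dots> = complex_of_real (real (card P) * (\<Sum>A\<in>D. w A))"
    by (simp add: sum_distrib_left)
  finally have "R = real (card P) * (\<Sum>A\<in>D. w A)"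
    by (simp only: of_real_eq_iff)
  also have "(\<Sum>A\<in>D. w A) = 1 + WF b s n P"
    using sum.remove[OF finD, of "\<one>\<^bsub>G\<^esub>" w] zero_mem_perp[of b s n P]
    by (simp add: WF_def D_def G_def w_def dick_weight_zero)
  finally show ?thesis
    using card by (simp add: R_def[symmetric])
qed

end
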